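(* Let $K\in[0,\mu(\Omega)]$ and suppose that $\mathbf{u}\in F$ is a feasible point. Then $\mathbf{u}$ is a B-stationary point of the problem "minimize $f(\mathbf{v})$ over $\mathbf{v}\in\mathbb{R}^{n_V}$ subject to $\|\mathbf{w}(\mathbf{v})\|_{0,\nu}\le K$" if and only if $$\sum_{\ell\in V}\nabla f(\mathbf{u})_\ell=0\quad\text{for all } V\in\mathcal{V}(\mathbf{u}),$$ where $$\mathcal{V}(\mathbf{u}):=\Big\{V\subseteq\{1,\dots,n_V\} : V\text{ is connected and }\|\mathbf{w}(\mathbf{u})\|_{0,\nu}+\sum_{i\in\mathcal{C}(\mathbf{u})\cap(\mathrm{cells}(V)\setminus\mathrm{cov}(V))}\nu_i\le K\Big\}.$$
   Context: Mesh: $\Omega\subseteq\mathbb{R}^d$ ($d\in\mathbb{N}$) is a bounded polyhedral domain with a geometrically conforming simplicial mesh: $\overline\Omega$ is the union of finitely many non-degenerate closed $d$-simplices (cells) $S_1,\dots,S_{n_S}$, any two of which intersect in a common face or not at all. $n_V,n_E,n_S$ are the numbers of vertices, edges and cells. $\mu$ is the Lebesgue measure and $\nu_i:=\mu(S_i)>0$, so $\sum_i\nu_i=\mu(\Omega)$. Matrices: fix for each edge an ordering of its two vertices. $D_1\in\mathbb{R}^{n_E\times n_V}$ has entry $(D_1)_{j,\ell}=1$ if $\ell$ is the first vertex of edge $j$, $-1$ if it is the second, $0$ otherwise. $D_2\in\mathbb{R}^{n_S\times n_E}$ has $(D_2)_{i,j}=1$ if edge $j$ is an edge of cell $S_i$,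 $0$ otherwise. For $\mathbf{u}\in\mathbb{R}^{n_V}$ put $\mathbf{w}(\mathbf{u}):=D_2[(D_1\mathbf{u})\odot(D_1\mathbf{u})]\in\mathbb{R}^{n_S}$ ($\odot$ componentwise product), $\mathcal{C}(\mathbf{u}):=\{i:\mathbf{w}(\mathbf{u})_i=0\}$. For $x\in\mathbb{R}^{n_S}$, $\|x\|_{0,\nu}:=\sum_{i:x_i\ne0}\nu_i$. Feasible set: $F:=\{\mathbf{u}\in\mathbb{R}^{n_V}:\|\mathbf{w}(\mathbf{u})\|_{0,\nu}\le K\}$. Standing assumptions on $f$: $f\colon\mathbb{R}^{n_V}\to\mathbb{R}\cup\{+\infty\}$ is proper, lower semicontinuous, radially unbounded ($f(\mathbf u)\to+\infty$ as $\|\mathbf u\|\to\infty$) and differentiable. Tangent cone: $T_F(\mathbf{u}):=\{\mathbf{d}\in\mathbb{R}^{n_V}:\exists\,(\mathbf{u}^{(k)})\subseteq F,\ \mathbf{u}^{(k)}\to\mathbf{u},\ \tau^{(k)}\searrow0,\ \mathbf{d}=\lim_k(\mathbf{u}^{(k)}-\mathbf{u})/\tau^{(k)}\}$ (with $\tau^{(k)}>0$). A point $\mathbf{u}\in F$ is B-stationary if $f'(\mathbf{u})\,\mathbf{d}\ge0$ for all $\mathbf{d}\in T_F(\mathbf{u})$. A subset $V\subseteq\{1,\dots,n_V\}$ of vertices is connected if any two vertices in $V$ are connected via mesh edges visiting only vertices in $V$. $\mathrm{cells}(V)$ is the set of indices of cells having at least one vertex in $V$; $\mathrm{cov}(V)$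 is the set of indices $i$ of cells all of whose vertices lie in $V$ (cells covered by $V$). *)

theory Defs
  imports "HOL-Analysis.Analysis"
begin

section \<open>Simplicial meshes\<close>

text \<open>
  A polyhedral domain is a nonempty connected open set whose boundary is made up of finitely many
  polytopes (necessarily of positive codimension).  Slits are not excluded.
\<close>

definition polyhedral_domain :: "'a::euclidean_space set \<Rightarrow> bool" where
  "polyhedral_domain \<Omega> \<longleftrightarrow> open \<Omega> \<and> connected \<Omega> \<and> \<Omega> \<noteq> {} \<and>
     (\<exists>\<P>. finite \<P> \<and> (\<forall>P\<in>\<P>. polytope P) \<and> frontier \<Omega> = \<Union>\<P>)"

text \<open>
  Vertices, edges and cells are indexed by the finite types \<open>'v\<close>, \<open>'e\<close> and \<open>'s\<close>, whose
  cardinalities are thus the numbers of vertices, edges and cells.  The functions \<open>v1\<close> and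
  \<open>v2\<close> give the first and the second vertex of each edge.  Note that \<^const>\<open>triangulation\<close>
  only requires that two cells meet in a common face, where the empty set counts as a face;
  faces of the cells are not members of the triangulation.
\<close>

locale simplicial_mesh =
  fixes \<Omega> :: "(real ^ 'd) set"
    and vert :: "'v::finite \<Rightarrow> real ^ 'd"
    and edge :: "'e::finite \<Rightarrow> (real ^ 'd) set"
    and cell :: "'s::finite \<Rightarrow> (real ^ 'd) set"
    and v1 v2 :: "'e \<Rightarrow> 'v"
  assumes bounded_domain: "bounded \<Omega>"
    and polyhedral_domain: "polyhedral_domain \<Omega>"
    and cell_simplex: "\<And>i. int CARD('d) simplex cell i"
    and cell_inj: "inj cell"
    and cell_conforming: "triangulation (range cell)"
    and cell_cover: "closure \<Omega> = (\<Union>i. cell i)"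
    and vert_bij: "bij_betw vert UNIV {x. \<exists>i. x extreme_point_of cell i}"
    and edge_bij: "bij_betw edge UNIV {E. \<exists>i. E edge_of cell i}"
    and edge_vertices: "\<And>j. {x. x extreme_point_of edge j} = {vert (v1 j), vert (v2 j)}"

section \<open>The discrete problem\<close>

definition D1 :: "('e::finite \<Rightarrow> 'v::finite) \<Rightarrow> ('e \<Rightarrow> 'v) \<Rightarrow> real ^ 'v ^ 'e" where
  "D1 v1 v2 = (\<chi> j l. if l = v1 j then 1 else if l = v2 j then - 1 else 0)"

definition D2 :: "('e::finite \<Rightarrow> (real ^ 'd) set) \<Rightarrow> ('s::finite \<Rightarrow> (real ^ 'd) set) \<Rightarrow> real ^ 'e ^ 's"
  where "D2 edge cell = (\<chi> i j. if edge j edge_of cell i then 1 else 0)"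

text \<open>The product of vectors in the following definition is the componentwise one.\<close>

definition jump_vec ::
  "('e::finite \<Rightarrow> (real ^ 'd) set) \<Rightarrow> ('s::finite \<Rightarrow> (real ^ 'd) set) \<Rightarrow>
   ('e \<Rightarrow> 'v::finite) \<Rightarrow> ('e \<Rightarrow> 'v) \<Rightarrow> real ^ 'v \<Rightarrow> real ^ 's" where
  "jump_vec edge cell v1 v2 u = D2 edge cell *v ((D1 v1 v2 *v u) * (D1 v1 v2 *v u))"

definition const_cells ::
  "('e::finite \<Rightarrow> (real ^ 'd) set) \<Rightarrow> ('s::finite \<Rightarrow> (real ^ 'd) set) \<Rightarrow>
   ('e \<Rightarrow> 'v::finite) \<Rightarrow> ('e \<Rightarrow> 'v) \<Rightarrow> real ^ 'v \<Rightarrow> 's set" where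
  "const_cells edge cell v1 v2 u = {i. jump_vec edge cell v1 v2 u $ i = 0}"

definition vol :: "('s \<Rightarrow> (real ^ 'd) set) \<Rightarrow> 's \<Rightarrow> real" where
  "vol cell i = measure lebesgue (cell i)"

definition weighted_l0 :: "('s \<Rightarrow> real) \<Rightarrow> real ^ 's::finite \<Rightarrow> real" where
  "weighted_l0 \<nu> x = (\<Sum>i | x $ i \<noteq> 0. \<nu> i)"

definition feasible_set ::
  "('e::finite \<Rightarrow> (real ^ 'd) set) \<Rightarrow> ('s::finite \<Rightarrow> (real ^ 'd) set) \<Rightarrow>
   ('e \<Rightarrow> 'v::finite) \<Rightarrow> ('e \<Rightarrow> 'v) \<Rightarrow> real \<Rightarrow> (real ^ 'v) set" where
  "feasible_set edge cell v1 v2 K = {u. weighted_l0 (vol cell) (jump_vec edge cell v1 v2 u) \<le> K}"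

section \<open>Extended-real-valued objectives and B-stationarity\<close>

definition proper_fun :: "('a \<Rightarrow> ereal) \<Rightarrow> bool" where
  "proper_fun f \<longleftrightarrow> (\<forall>x. f x \<noteq> - \<infinity>) \<and> (\<exists>x. f x < \<infinity>)"

definition lower_semicontinuous :: "('a::topological_space \<Rightarrow> ereal) \<Rightarrow> bool" where
  "lower_semicontinuous f \<longleftrightarrow> (\<forall>x. f x \<le> Liminf (at x) f)"

definition radially_unbounded :: "('a::real_normed_vector \<Rightarrow> ereal) \<Rightarrow> bool" where
  "radially_unbounded f \<longleftrightarrow> (f \<longlongrightarrow> \<infinity>) at_infinity"

text \<open>
  An extended-real-valued function is differentiable at a point if it is finite around that point
  and differentiable there as a real-valued function.  It is called differentiable if it is so at
  every point of its effective domain; for a function that is finite everywhere this is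
  differentiability everywhere.
\<close>

definition ereal_differentiable_at ::
  "('a::real_normed_vector \<Rightarrow> ereal) \<Rightarrow> 'a \<Rightarrow> bool" where
  "ereal_differentiable_at f u \<longleftrightarrow>
     (\<forall>\<^sub>F v in nhds u. \<bar>f v\<bar> \<noteq> \<infinity>) \<and> (\<lambda>v. real_of_ereal (f v)) differentiable (at u)"

definition ereal_differentiable :: "('a::real_normed_vector \<Rightarrow> ereal) \<Rightarrow> bool" where
  "ereal_differentiable f \<longleftrightarrow> (\<forall>u. f u < \<infinity> \<longrightarrow> ereal_differentiable_at f u)"

definition ereal_derivative ::
  "('a::real_normed_vector \<Rightarrow> ereal) \<Rightarrow> 'a \<Rightarrow> 'a \<Rightarrow> real" where
  "ereal_derivative f u = frechet_derivative (\<lambda>v. real_of_ereal (f v)) (at u)"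

definition ereal_gradient :: "('a::real_inner \<Rightarrow> ereal) \<Rightarrow> 'a \<Rightarrow> 'a" where
  "ereal_gradient f u = (THE g. GDERIV (\<lambda>v. real_of_ereal (f v)) u :> g)"

definition tangent_cone :: "'a::real_normed_vector set \<Rightarrow> 'a \<Rightarrow> 'a set" where
  "tangent_cone F u = {d. \<exists>(x :: nat \<Rightarrow> 'a) (\<tau> :: nat \<Rightarrow> real).
     (\<forall>k. x k \<in> F) \<and> x \<longlonglongrightarrow> u \<and> (\<forall>k. \<tau> k > 0) \<and> \<tau> \<longlonglongrightarrow> 0 \<and>
     (\<lambda>k. (x k - u) /\<^sub>R \<tau> k) \<longlonglongrightarrow> d}"

definition B_stationary :: "('a::real_normed_vector \<Rightarrow> ereal) \<Rightarrow> 'a set \<Rightarrow> 'a \<Rightarrow> bool" where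
  "B_stationary f F u \<longleftrightarrow> u \<in> F \<and> (\<forall>d \<in> tangent_cone F u. ereal_derivative f u d \<ge> 0)"

section \<open>Sets of vertices\<close>

definition connected_vertices :: "('e \<Rightarrow> 'v) \<Rightarrow> ('e \<Rightarrow> 'v) \<Rightarrow> 'v set \<Rightarrow> bool" where
  "connected_vertices v1 v2 V \<longleftrightarrow>
     (\<forall>p\<in>V. \<forall>q\<in>V. (p, q) \<in> {(a, b). a \<in> V \<and> b \<in> V \<and> (\<exists>j. {a, b} = {v1 j, v2 j})}\<^sup>*)"

definition cells_of ::
  "('v \<Rightarrow> real ^ 'd) \<Rightarrow> ('s \<Rightarrow> (real ^ 'd) set) \<Rightarrow> 'v set \<Rightarrow> 's set" where
  "cells_of vert cell V = {i. \<exists>l\<in>V. vert l extreme_point_of cell i}"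

definition cov ::
  "('v \<Rightarrow> real ^ 'd) \<Rightarrow> ('s \<Rightarrow> (real ^ 'd) set) \<Rightarrow> 'v set \<Rightarrow> 's set" where
  "cov vert cell V = {i. \<forall>l. vert l extreme_point_of cell i \<longrightarrow> l \<in> V}"

definition admissible_vertex_sets ::
  "('v::finite \<Rightarrow> real ^ 'd) \<Rightarrow> ('e::finite \<Rightarrow> (real ^ 'd) set) \<Rightarrow>
   ('s::finite \<Rightarrow> (real ^ 'd) set) \<Rightarrow> ('e \<Rightarrow> 'v) \<Rightarrow> ('e \<Rightarrow> 'v) \<Rightarrow> real \<Rightarrow> real ^ 'v \<Rightarrow> 'v set set" where
  "admissible_vertex_sets vert edge cell v1 v2 K u =
     {V. connected_vertices v1 v2 V \<and>
         weighted_l0 (vol cell) (jump_vec edge cell v1 v2 u) +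
         (\<Sum>i \<in> const_cells edge cell v1 v2 u \<inter> (cells_of vert cell V - cov vert cell V). vol cell i)
         \<le> K}"

end

theory Submission
  imports Defs
begin

text \<open>
  A cell is constant for \<open>u\<close> iff \<open>u\<close> takes a single value on its vertices, because any two vertices
  of a simplex span an edge.  Near \<open>u\<close> no cell with a jump can become constant, so a tangent
  direction \<open>d\<close> at \<open>u\<close> has the property that the cells on which \<open>u\<close> or \<open>d\<close> jumps have total volume
  at most \<open>K\<close>.  Split \<open>d\<close> along the connected components of its level sets: a cell that meets such a
  component \<open>V\<close> without being covered by it is one on which \<open>d\<close> jumps, so \<open>V\<close> is admissible and
  contributes nothing to the directional derivative.  Conversely, if \<open>V\<close> is admissible, the whole
  line through \<open>u\<close> in the direction of the indicator of \<open>V\<close> is feasible.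
\<close>

section \<open>Gradients of extended-real-valued functions\<close>

lemma GDERIV_unique:
  assumes "GDERIV f x :> a" "GDERIV f x :> b"
  shows "a = b"
proof -
  have "(\<lambda>h. h \<bullet> a) = (\<lambda>h. h \<bullet> b)"
    using assms unfolding gderiv_def by (rule has_derivative_unique)
  then show ?thesis
    by (metis inner_commute vector_eq_rdot)
qed

text \<open>Riesz representation in finite dimension: the adjoint of the derivative, applied to 1,
  represents it as an inner product.\<close>

lemma differentiable_imp_GDERIV:
  fixes f :: "'a::euclidean_space \<Rightarrow> real"
  assumes "f differentiable (at x)"
  shows "\<exists>g. GDERIV f x :> g"
proof -
  obtain f' where f': "(f has_derivative f') (at x)"
    using assms by (auto simp: differentiable_def)
  interpret bounded_linear f' using f' by (rule has_derivative_bounded_linear)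
  have "f' = (\<lambda>h. h \<bullet> adjoint f' 1)"
    using adjoint_works[OF linear_axioms, of _ 1] by (simp add: fun_eq_iff)
  with f' show ?thesis unfolding gderiv_def by metis
qed

text \<open>Existence and uniqueness of the gradient make the definite description in
  \<open>ereal_gradient\<close> meaningful.\<close>

lemma ereal_derivative_eq_gradient:
  fixes f :: "'a::euclidean_space \<Rightarrow> ereal"
  assumes "ereal_differentiable_at f u"
  shows "ereal_derivative f u d = d \<bullet> ereal_gradient f u"
proof -
  have "\<exists>g. GDERIV (\<lambda>v. real_of_ereal (f v)) u :> g"
    using assms by (intro differentiable_imp_GDERIV) (simp add: ereal_differentiable_at_def)
  then have "GDERIV (\<lambda>v. real_of_ereal (f v)) u :> ereal_gradient f u"
    unfolding ereal_gradient_def by (metis GDERIV_unique the_equality)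
  then show ?thesis
    unfolding ereal_derivative_def gderiv_def by (metis frechet_derivative_at)
qed

section \<open>Edges of a cell and the jump vector\<close>

context simplicial_mesh
begin

lemma inj_vert: "vert l = vert m \<longleftrightarrow> l = m"
  using vert_bij by (auto simp: bij_betw_def inj_eq)

lemma edge_endpoints:
  assumes "edge j edge_of cell i"
  shows "vert (v1 j) extreme_point_of cell i" "vert (v2 j) extreme_point_of cell i" "v1 j \<noteq> v2 j"
proof -
  have face: "edge j face_of cell i" and dim: "aff_dim (edge j) = 1"
    using assms by (auto simp: edge_of_def)
  have "{vert (v1 j), vert (v2 j)} \<subseteq> {x. x extreme_point_of cell i}"
    using edge_vertices[of j] extreme_point_of_face[OF face] by blast
  then show "vert (v1 j) extreme_point_of cell i" "vert (v2 j) extreme_point_of cell i"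
    by auto
  have "polytope (edge j)"
    using face cell_simplex face_of_polytope_polytope simplex_imp_polytope by blast
  then have "edge j = convex hull {vert (v1 j), vert (v2 j)}"
    using Krein_Milman_Minkowski[of "edge j"] edge_vertices[of j]
    by (simp add: polytope_imp_compact polytope_imp_convex)
  \<comment> \<open>With equal endpoints the edge would be a single point, of dimension 0 instead of
    1.\<close>
  then show "v1 j \<noteq> v2 j"
    using dim by auto
qed

text \<open>The points spanning a simplex are affinely independent, so every subset of them spans a
  face, and two distinct ones span an edge.\<close>

lemma cell_vertices_joined:
  assumes l: "vert l extreme_point_of cell i" and m: "vert m extreme_point_of cell i"
    and "l \<noteq> m"
  obtains j where "edge j edge_of cell i" "{l, m} = {v1 j, v2 j}"
proof -
  let ?E = "convex hull {vert l, vert m}"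
  obtain C where C: "\<not> affine_dependent C" "cell i = convex hull C"
    using cell_simplex[of i] unfolding simplex_def by blast
  have "{vert l, vert m} \<subseteq> C"
    using l m C extreme_point_of_convex_hull by auto
  then have "?E face_of cell i"
    unfolding C(2) face_of_convex_hull_affine_independent[OF C(1)]
    by (intro exI[of _ "{vert l, vert m}"]) simp
  then have E: "?E edge_of cell i"
    using \<open>l \<noteq> m\<close> by (simp add: edge_of_def aff_dim_convex_hull aff_dim_2 inj_vert)
  then have "?E \<in> {E. \<exists>i. E edge_of cell i}"
    by (intro CollectI exI)
  then have "?E \<in> range edge"
    by (simp only: bij_betw_imp_surj_on[OF edge_bij])
  then obtain j where j: "?E = edge j"
    by (rule rangeE)
  have "{x. x extreme_point_of ?E} = {vert l, vert m}"
    unfolding extreme_point_of_convex_hull_2 by blast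
  then have "{vert l, vert m} = {vert (v1 j), vert (v2 j)}"
    using edge_vertices[of j] unfolding j by (rule subst)
  then have "{l, m} = {v1 j, v2 j}"
    by (simp only: doubleton_eq_iff inj_vert)
  with E show thesis unfolding j by (rule that)
qed

text \<open>The jump of cell \<open>i\<close> is the sum of squared differences of \<open>u\<close>
  along its edges, so it vanishes only if each of them does. The edges join any two vertices of the
  cell.\<close>

lemma const_cells_iff:
  "i \<in> const_cells edge cell v1 v2 u \<longleftrightarrow>
     (\<forall>l m. vert l extreme_point_of cell i \<longrightarrow> vert m extreme_point_of cell i \<longrightarrow> u $ l = u $ m)"
proof -
  \<comment> \<open>For equal endpoints the first case in \<open>D1\<close> would win, and the row
    would not give a difference.\<close>
  have D1: "(D1 v1 v2 *v u) $ j = u $ v1 j - u $ v2 j" if "v1 j \<noteq> v2 j" for j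
  proof -
    have "(D1 v1 v2 *v u) $ j
        = (\<Sum>l\<in>UNIV. (if l = v1 j then u $ l else 0) - (if l = v2 j then u $ l else 0))"
      unfolding D1_def matrix_vector_mult_def using that by (auto intro!: sum.cong)
    then show ?thesis by (simp add: sum_subtractf)
  qed
  have "i \<in> const_cells edge cell v1 v2 u \<longleftrightarrow>
      (\<Sum>j\<in>UNIV. (if edge j edge_of cell i then 1 else 0) * ((D1 v1 v2 *v u) $ j)\<^sup>2) = 0"
    by (simp add: const_cells_def jump_vec_def D2_def matrix_vector_mult_def power2_eq_square)
  also have "\<dots> \<longleftrightarrow> (\<forall>j. edge j edge_of cell i \<longrightarrow> (D1 v1 v2 *v u) $ j = 0)"
    by (subst sum_nonneg_eq_0_iff) auto
  also have "\<dots> \<longleftrightarrow> (\<forall>j. edge j edge_of cell i \<longrightarrow> u $ v1 j = u $ v2 j)"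
    by (metis D1 edge_endpoints(3) eq_iff_diff_eq_0)
  also have "\<dots> \<longleftrightarrow> (\<forall>l m. vert l extreme_point_of cell i \<longrightarrow>
      vert m extreme_point_of cell i \<longrightarrow> u $ l = u $ m)"
  proof (intro iffI allI impI)
    fix l m assume edges: "\<forall>j. edge j edge_of cell i \<longrightarrow> u $ v1 j = u $ v2 j"
      and lm: "vert l extreme_point_of cell i" "vert m extreme_point_of cell i"
    show "u $ l = u $ m"
    proof (cases "l = m")
      case False
      then obtain j where "edge j edge_of cell i" "{l, m} = {v1 j, v2 j}"
        using cell_vertices_joined lm by blast
      then show ?thesis
        using edges by (auto simp: doubleton_eq_iff)
    qed simp
  qed (use edge_endpoints(1,2) in blast)
  finally show ?thesis .
qed

lemma weighted_l0_jump_vec: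
  "weighted_l0 (vol cell) (jump_vec edge cell v1 v2 u) = sum (vol cell) (- const_cells edge cell v1 v2 u)"
  unfolding weighted_l0_def const_cells_def by (rule sum.cong) auto

lemma vol_nonneg: "0 \<le> vol cell i"
  by (simp add: vol_def)

lemma feasible_set_iff:
  "u \<in> feasible_set edge cell v1 v2 K \<longleftrightarrow> sum (vol cell) (- const_cells edge cell v1 v2 u) \<le> K"
  by (simp add: feasible_set_def weighted_l0_jump_vec)

text \<open>The two volume sums run over disjoint sets of cells. Merged into one sum over a union,
  they can be compared by monotonicity.\<close>

lemma admissible_vertex_sets_iff:
  "V \<in> admissible_vertex_sets vert edge cell v1 v2 K u \<longleftrightarrow>
     connected_vertices v1 v2 V \<and>
     sum (vol cell) (- const_cells edge cell v1 v2 u \<union> (cells_of vert cell V - cov vert cell V)) \<le> K"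
proof -
  let ?C = "const_cells edge cell v1 v2 u" and ?B = "cells_of vert cell V - cov vert cell V"
  have "- ?C \<union> ?B = - ?C \<union> ?C \<inter> ?B"
    by blast
  then have "sum (vol cell) (- ?C \<union> ?B) = sum (vol cell) (- ?C) + sum (vol cell) (?C \<inter> ?B)"
    by (simp add: sum.union_disjoint Int_assoc[symmetric])
  then show ?thesis
    by (simp add: admissible_vertex_sets_def weighted_l0_jump_vec)
qed

section \<open>Tangent directions\<close>

lemma tangent_cone_feasible_set:
  assumes "d \<in> tangent_cone (feasible_set edge cell v1 v2 K) u"
  shows "sum (vol cell) (- const_cells edge cell v1 v2 u \<union> - const_cells edge cell v1 v2 d) \<le> K"
proof -
  let ?C = "const_cells edge cell v1 v2"
  obtain x :: "nat \<Rightarrow> real ^ 'v" and \<tau> where x: "\<And>k. x k \<in> feasible_set edge cell v1 v2 K" "x \<longlonglongrightarrow> u"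
    and \<tau>: "\<And>k. \<tau> k > 0" and d: "(\<lambda>k. (x k - u) /\<^sub>R \<tau> k) \<longlonglongrightarrow> d"
    using assms unfolding tangent_cone_def by blast
  have "\<forall>\<^sub>F k in sequentially. i \<in> - ?C u \<union> - ?C d \<longrightarrow> i \<notin> ?C (x k)" for i
  proof (cases "i \<in> ?C u")
    case False
    then obtain l m where lm: "vert l extreme_point_of cell i" "vert m extreme_point_of cell i"
      "u $ l - u $ m \<noteq> 0"
      by (auto simp: const_cells_iff)
    have "(\<lambda>k. x k $ l - x k $ m) \<longlonglongrightarrow> u $ l - u $ m"
      using x(2) by (intro tendsto_intros)
    then have "\<forall>\<^sub>F k in sequentially. x k $ l - x k $ m \<noteq> 0"
      using lm(3) by (rule tendsto_imp_eventually_ne)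
    then show ?thesis
      by eventually_elim (use lm in \<open>auto simp: const_cells_iff\<close>)
  next
    case u: True
    show ?thesis
    proof (cases "i \<in> ?C d")
      case False
      then obtain l m where lm: "vert l extreme_point_of cell i" "vert m extreme_point_of cell i"
        "d $ l - d $ m \<noteq> 0"
        by (auto simp: const_cells_iff)
      have "(\<lambda>k. ((x k - u) /\<^sub>R \<tau> k) $ l - ((x k - u) /\<^sub>R \<tau> k) $ m) \<longlonglongrightarrow> d $ l - d $ m"
        using d by (intro tendsto_diff tendsto_vec_nth)
      then have "\<forall>\<^sub>F k in sequentially.
          ((x k - u) /\<^sub>R \<tau> k) $ l - ((x k - u) /\<^sub>R \<tau> k) $ m \<noteq> 0"
        using lm(3) by (rule tendsto_imp_eventually_ne)
      \<comment> \<open>Hence \<open>u\<close> cancels from the difference of the quotients, which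
        is the jump of \<open>x k\<close> divided by \<open>\<tau> k\<close>.\<close>
      moreover have "u $ l = u $ m"
        using u lm unfolding const_cells_iff by blast
      ultimately show ?thesis
        by (elim eventually_mono) (use lm in \<open>auto simp: const_cells_iff\<close>)
    qed (use u in auto)
  qed
  \<comment> \<open>There are finitely many cells, so a single \<open>k\<close> serves all of
    them.\<close>
  then have "\<forall>\<^sub>F k in sequentially. \<forall>i. i \<in> - ?C u \<union> - ?C d \<longrightarrow> i \<notin> ?C (x k)"
    by (rule eventually_all_finite)
  then obtain k where "- ?C u \<union> - ?C d \<subseteq> - ?C (x k)"
    by (auto simp: eventually_sequentially)
  then have "sum (vol cell) (- ?C u \<union> - ?C d) \<le> sum (vol cell) (- ?C (x k))"
    by (intro sum_mono2) (auto simp: vol_nonneg)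
  also have "\<dots> \<le> K"
    using x(1) by (simp add: feasible_set_iff)
  finally show ?thesis .
qed

text \<open>The factor \<open>c\<close> may have either sign; this is what later turns an inequality
  for the derivative into an equation.\<close>

lemma tangent_cone_indicator:
  assumes V: "V \<in> admissible_vertex_sets vert edge cell v1 v2 K u"
  shows "(\<chi> l. if l \<in> V then c else 0) \<in> tangent_cone (feasible_set edge cell v1 v2 K) u"
proof -
  let ?C = "const_cells edge cell v1 v2"
  let ?d = "(\<chi> l. if l \<in> V then c else 0) :: real ^ 'v"
  have feas: "u + t *\<^sub>R ?d \<in> feasible_set edge cell v1 v2 K" for t
  proof -
    \<comment> \<open>Such a cell has all of its vertices in \<open>V\<close> or none, so
      \<open>u\<close> is shifted by the same amount at each of them.\<close>
    have "i \<in> ?C (u + t *\<^sub>R ?d)" if "i \<in> ?C u" "i \<notin> cells_of vert cell V - cov vert cell V" for i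
      unfolding const_cells_iff
    proof (intro allI impI)
      fix l m
      assume lm: "vert l extreme_point_of cell i" "vert m extreme_point_of cell i"
      have "l \<in> V \<longleftrightarrow> m \<in> V"
        using that(2) lm unfolding cells_of_def cov_def by blast
      moreover have "u $ l = u $ m"
        using that(1) lm unfolding const_cells_iff by blast
      ultimately show "(u + t *\<^sub>R ?d) $ l = (u + t *\<^sub>R ?d) $ m"
        by simp
    qed
    then have "- ?C (u + t *\<^sub>R ?d) \<subseteq> - ?C u \<union> (cells_of vert cell V - cov vert cell V)"
      by blast
    then have "sum (vol cell) (- ?C (u + t *\<^sub>R ?d))
        \<le> sum (vol cell) (- ?C u \<union> (cells_of vert cell V - cov vert cell V))"
      by (intro sum_mono2) (auto simp: vol_nonneg)
    also have "\<dots> \<le> K"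
      using V by (simp add: admissible_vertex_sets_iff)
    finally show ?thesis by (simp add: feasible_set_iff)
  qed
  \<comment> \<open>Any positive null sequence would do, since along the line the difference
    quotients are constant.\<close>
  let ?\<tau> = "\<lambda>k. inverse (real (Suc k))"
  have \<tau>: "?\<tau> \<longlonglongrightarrow> 0" by (rule LIMSEQ_inverse_real_of_nat)
  then have "(\<lambda>k. u + ?\<tau> k *\<^sub>R ?d) \<longlonglongrightarrow> u + 0 *\<^sub>R ?d"
    by (intro tendsto_intros)
  moreover have "(\<lambda>k. (u + ?\<tau> k *\<^sub>R ?d - u) /\<^sub>R ?\<tau> k) = (\<lambda>k. ?d)"
    by (simp add: fun_eq_iff)
  ultimately show ?thesis
    unfolding tangent_cone_def using feas \<tau>
    by (auto intro!: exI[of _ "\<lambda>k. u + ?\<tau> k *\<^sub>R ?d"] exI[of _ ?\<tau>] simp del: of_nat_Suc)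
qed

section \<open>Components of level sets\<close>

text \<open>Paths along edges with equal end values of \<open>d\<close> never leave a level set, so
  this is the connected component of \<open>l\<close> in the subgraph induced by its level
  set.\<close>

definition level_component :: "real ^ 'v \<Rightarrow> 'v \<Rightarrow> 'v set" where
  "level_component d l = {(a, b). d $ a = d $ b \<and> (\<exists>j. {a, b} = {v1 j, v2 j})}\<^sup>* `` {l}"

lemma level_component_const:
  assumes "m \<in> level_component d l"
  shows "d $ m = d $ l"
proof -
  have "(l, m) \<in> {(a, b). d $ a = d $ b \<and> (\<exists>j. {a, b} = {v1 j, v2 j})}\<^sup>*"
    using assms by (simp add: level_component_def)
  then show ?thesis by induction auto
qed

lemma level_component_self: "l \<in> level_component d l"
  by (simp add: level_component_def)

text \<open>Unordered pairs make the step relation symmetric. Its closure is thus an equivalence,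
  whose classes partition the vertices.\<close>

lemma level_component_eq_iff:
  "level_component d m = level_component d l \<longleftrightarrow> m \<in> level_component d l"
proof -
  let ?R = "{(a, b). d $ a = d $ b \<and> (\<exists>j. {a, b} = {v1 j, v2 j})}"
  have "sym (?R\<^sup>*)"
    by (intro sym_rtrancl symI) (auto simp: insert_commute)
  then have "equiv UNIV (?R\<^sup>*)"
    by (simp add: equiv_def refl_rtrancl trans_rtrancl)
  from eq_equiv_class_iff[OF this, of l m] show ?thesis
    unfolding level_component_def by auto
qed

lemma connected_level_component: "connected_vertices v1 v2 (level_component d l)"
proof -
  let ?R = "{(a, b). d $ a = d $ b \<and> (\<exists>j. {a, b} = {v1 j, v2 j})}"
  \<comment> \<open>Each vertex on a path from \<open>p\<close> is itself reachable from
    \<open>p\<close>, so the path stays in the component. Basing the component at \<open>p\<close>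
    suits the induction; it is identified with that of \<open>l\<close> afterwards.\<close>
  have path: "(p, q) \<in> {(a, b). a \<in> level_component d p \<and> b \<in> level_component d p \<and>
      (\<exists>j. {a, b} = {v1 j, v2 j})}\<^sup>*" if "(p, q) \<in> ?R\<^sup>*" for p q
    using that
  proof induction
    case (step a b)
    then have "a \<in> level_component d p" "b \<in> level_component d p"
      unfolding level_component_def by (auto intro: rtrancl_into_rtrancl)
    with step show ?case
      by (auto intro!: rtrancl_into_rtrancl[of p a])
  qed simp
  show ?thesis
    unfolding connected_vertices_def
  proof (intro ballI)
    fix p q assume p: "p \<in> level_component d l" and q: "q \<in> level_component d l"
    have eq: "level_component d p = level_component d l"
      using p by (simp only: level_component_eq_iff)
    then have "(p, q) \<in> ?R\<^sup>*"
      using q unfolding level_component_def by blast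
    from path[OF this] show "(p, q) \<in> {(a, b). a \<in> level_component d l \<and> b \<in> level_component d l \<and>
        (\<exists>j. {a, b} = {v1 j, v2 j})}\<^sup>*"
      by (simp only: eq)
  qed
qed

text \<open>A vertex inside and one outside the component, both in one cell, are joined by an edge.
  Equal values of \<open>d\<close> there would pull the outer vertex into the component.\<close>

lemma level_component_boundary_cells:
  "cells_of vert cell (level_component d l) - cov vert cell (level_component d l)
     \<subseteq> - const_cells edge cell v1 v2 d"
proof
  fix i
  assume "i \<in> cells_of vert cell (level_component d l) - cov vert cell (level_component d l)"
  then obtain p q where p: "p \<in> level_component d l" "vert p extreme_point_of cell i"
    and q: "q \<notin> level_component d l" "vert q extreme_point_of cell i"
    by (auto simp: cells_of_def cov_def)
  then obtain j where "{p, q} = {v1 j, v2 j}"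
    using cell_vertices_joined by metis
  then have "d $ p \<noteq> d $ q"
    using p(1) q(1) unfolding level_component_def by (auto intro: rtrancl_into_rtrancl)
  then show "i \<in> - const_cells edge cell v1 v2 d"
    using p(2) q(2) unfolding const_cells_iff Compl_iff by blast
qed

lemma level_component_admissible:
  assumes "d \<in> tangent_cone (feasible_set edge cell v1 v2 K) u"
  shows "level_component d l \<in> admissible_vertex_sets vert edge cell v1 v2 K u"
proof -
  let ?C = "const_cells edge cell v1 v2"
  have "sum (vol cell) (- ?C u \<union>
        (cells_of vert cell (level_component d l) - cov vert cell (level_component d l)))
      \<le> sum (vol cell) (- ?C u \<union> - ?C d)"
    using level_component_boundary_cells[of d l] by (intro sum_mono2) (auto simp: vol_nonneg)
  also have "\<dots> \<le> K"
    using assms by (rule tangent_cone_feasible_set)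
  finally show ?thesis
    by (simp add: admissible_vertex_sets_iff connected_level_component)
qed

text \<open>The components partition the vertices, and \<open>d\<close> takes one value on each,
  read off at an arbitrary representative and pulled out of the sum.\<close>

lemma inner_eq_sum_level_components:
  "d \<bullet> g = (\<Sum>V \<in> range (level_component d). d $ (SOME l. l \<in> V) * (\<Sum>l\<in>V. g $ l))"
proof -
  have "d \<bullet> g = (\<Sum>l\<in>UNIV. d $ l * g $ l)"
    by (simp add: inner_vec_def)
  also have "\<dots> = (\<Sum>V \<in> range (level_component d). \<Sum>l | level_component d l = V. d $ l * g $ l)"
    using sum.group[of UNIV "range (level_component d)" "level_component d" "\<lambda>l. d $ l * g $ l"]
    by simp
  also have "\<dots> = (\<Sum>V \<in> range (level_component d). d $ (SOME l. l \<in> V) * (\<Sum>l\<in>V. g $ l))"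
  proof (rule sum.cong[OF refl])
    fix V assume "V \<in> range (level_component d)"
    then obtain m where V: "V = level_component d m" by blast
    have "(SOME l. l \<in> V) \<in> V"
      using level_component_self V by (metis someI)
    then have "d $ l = d $ (SOME l. l \<in> V)" if "l \<in> V" for l
      using that level_component_const V by metis
    moreover have "{l. level_component d l = V} = V"
      by (simp add: V level_component_eq_iff)
    ultimately show "(\<Sum>l | level_component d l = V. d $ l * g $ l)
        = d $ (SOME l. l \<in> V) * (\<Sum>l\<in>V. g $ l)"
      by (simp add: sum_distrib_left)
  qed
  finally show ?thesis .
qed

end

theorem theorem4p12:
  fixes \<Omega> :: "(real ^ 'd) set"
    and vert :: "'v::finite \<Rightarrow> real ^ 'd"
    and edge :: "'e::finite \<Rightarrow> (real ^ 'd) set"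
    and cell :: "'s::finite \<Rightarrow> (real ^ 'd) set"
    and v1 v2 :: "'e \<Rightarrow> 'v"
    and f :: "real ^ 'v \<Rightarrow> ereal"
    and K :: real
    and u :: "real ^ 'v"
  assumes mesh: "simplicial_mesh \<Omega> vert edge cell v1 v2"
    and f_proper: "proper_fun f"
    and f_lsc: "lower_semicontinuous f"
    and f_radially_unbounded: "radially_unbounded f"
    and f_differentiable: "ereal_differentiable f"
    and K: "K \<in> {0..measure lebesgue \<Omega>}"
    and u_feasible: "u \<in> feasible_set edge cell v1 v2 K"
    and u_dom: "f u < \<infinity>"
  shows "B_stationary f (feasible_set edge cell v1 v2 K) u \<longleftrightarrow>
    (\<forall>V \<in> admissible_vertex_sets vert edge cell v1 v2 K u.
       (\<Sum>l\<in>V. ereal_gradient f u $ l) = 0)"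
proof -
  interpret simplicial_mesh \<Omega> vert edge cell v1 v2 by (rule mesh)
  let ?T = "tangent_cone (feasible_set edge cell v1 v2 K) u"
  \<comment> \<open>Differentiability is granted on the effective domain only, hence the appeal to
    \<open>u_dom\<close>.\<close>
  have deriv: "ereal_derivative f u d = d \<bullet> ereal_gradient f u" for d
    using f_differentiable u_dom
    by (intro ereal_derivative_eq_gradient) (simp add: ereal_differentiable_def)
  have indicator: "(\<chi> l. if l \<in> V then c else 0) \<bullet> g = c * (\<Sum>l\<in>V. g $ l)"
    for V c and g :: "real ^ 'v"
    by (simp add: inner_vec_def if_distrib[of "\<lambda>x. x * _"] sum.If_cases sum_distrib_left cong: if_cong)
  show ?thesis
  proof
    assume B: "B_stationary f (feasible_set edge cell v1 v2 K) u"
    show "\<forall>V \<in> admissible_vertex_sets vert edge cell v1 v2 K u.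
       (\<Sum>l\<in>V. ereal_gradient f u $ l) = 0"
    proof
      fix V assume "V \<in> admissible_vertex_sets vert edge cell v1 v2 K u"
      then have "0 \<le> c * (\<Sum>l\<in>V. ereal_gradient f u $ l)" for c
        using B tangent_cone_indicator deriv indicator unfolding B_stationary_def by metis
      \<comment> \<open>Both signs of the indicator are tangent, which forces the sum to be
        zero.\<close>
      from this[of 1] this[of "-1"] show "(\<Sum>l\<in>V. ereal_gradient f u $ l) = 0"
        by simp
    qed
  next
    assume "\<forall>V \<in> admissible_vertex_sets vert edge cell v1 v2 K u.
       (\<Sum>l\<in>V. ereal_gradient f u $ l) = 0"
    \<comment> \<open>Every component of a level set of \<open>d\<close> is admissible, so each
      summand of the decomposition vanishes.\<close>
    then have "d \<bullet> ereal_gradient f u = 0" if "d \<in> ?T" for d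
      using level_component_admissible[OF that]
      by (subst inner_eq_sum_level_components) (auto intro!: sum.neutral)
    then show "B_stationary f (feasible_set edge cell v1 v2 K) u"
      using u_feasible deriv unfolding B_stationary_def by simp
  qed
qed

end
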